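(* Let $\mathcal{C}$ be a class of $(\mathbb{T},V)$-spaces containing at least one non-empty space. Then the full subcategory $(\mathbb{T},V)\text{-}\mathsf{Cat}_{\mathcal{C}}$ of $\mathcal{C}$-generated spaces is coreflective in $(\mathbb{T},V)\text{-}\mathsf{Cat}$.
   Context: Setting. $V=(V,\otimes,k)$ is a unital commutative quantale (a complete lattice with a commutative associative operation $\otimes$ with unit $k$ that preserves arbitrary suprema in each variable) which is also a Heyting algebra (each $u\wedge(-)$ has a right adjoint); $\bot,\top$ denote bottom and top. A $V$-relation $r\colon X\nrightarrow Y$ is a map $r\colon X\times Y\to V$; composition is $(s\cdot r)(x,z)=\bigvee_{y}r(x,y)\otimes s(y,z)$, the order is componentwise, and $r^{\circ}(y,x)=r(x,y)$. A map $f\colon X\to Y$ is regarded as the $V$-relation with $f(x,y)=k$ if $f(x)=y$ and $\bot$ otherwise. $\mathbb{T}=(T,m,e)$ is a monad on $\mathsf{Set}$ satisfying (BC): $T$ preserves weak pullbacks and the naturality squares of $m$ are weak pullbacks. A lax extension of $\mathbb{T}$ to $V$-relations is fixed, sending $r\colon X\nrightarrow Y$ to $Tr\colon TX\nrightarrow TY$: it is monotone, $Ts\cdot Tr\le T(s\cdot r)$, it is flat (the extension satisfies $T1_X=1_{TX}$, so that it agrees with $T$ on maps), $T(r^{\circ})=(Tr)^{\circ}$, $e_Y\cdot r\le Tr\cdot e_X$ and $m_Y\cdot TTr\le Tr\cdot m_X$. A $(\mathbb{T},V)$-space is a pair $(X,a)$ with $a\colon TX\nrightarrow X$ a $V$-relation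 such that $1_X\le a\cdot e_X$ and $a\cdot Ta\le a\cdot m_X$. A map $f\colon(X,a)\to(Y,b)$ is $(\mathbb{T},V)$-continuous if $f\cdot a\le b\cdot Tf$, i.e. $a(\mathfrak{x},x)\le b(Tf(\mathfrak{x}),f(x))$ for all $\mathfrak{x}\in TX,x\in X$. These form the category $(\mathbb{T},V)\text{-}\mathsf{Cat}$, whose forgetful functor to $\mathsf{Set}$ is topological. Standing assumption: every constant map between $(\mathbb{T},V)$-spaces is continuous. For a class $\mathcal{C}$ of spaces, a probe over $(X,a)$ is a continuous map $p\colon C\to(X,a)$ with $C\in\mathcal{C}$. The $\mathcal{C}$-generated structure $a^{c}$ on $X$ is the final structure with respect to all probes over $(X,a)$: the $(\mathbb{T},V)$-structure such that, for every space $(Y,b)$, a map $g\colon(X,a^{c})\to(Y,b)$ is continuous iff $g\cdot p$ is continuous for every probe $p$ over $(X,a)$. The space $(X,a)$ is $\mathcal{C}$-generated if $a=a^{c}$. *)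

theory Defs
  imports Main "HOL-Library.FuncSet"
begin

section \<open>Quantales\<close>

text \<open>The tensor is \<open>*\<close>, its unit \<open>k\<close> is \<open>1\<close>. Commutativity gives preservation of
  suprema in the other variable.\<close>

class comm_quantale = complete_lattice + comm_monoid_mult +
  assumes mult_Sup: "x * Sup A = Sup ((\<lambda>y. x * y) ` A)"

class heyting_comm_quantale = comm_quantale +
  assumes inf_has_right_adjoint: "\<exists>h. \<forall>v w. inf u v \<le> w \<longleftrightarrow> v \<le> h w"

section \<open>Relations with values in a quantale\<close>

text \<open>A relation from \<open>X\<close> to \<open>Y\<close> is extended by \<open>\<bottom>\<close> outside \<open>X \<times> Y\<close>. Hence equality and the
  (pointwise) order of functions are equality and order of relations, and the supremum in the
  composite may range over the whole type, as \<open>\<bottom>\<close> is absorbing for the tensor.\<close>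

definition vrel :: "'u set \<Rightarrow> 'u set \<Rightarrow> ('u \<Rightarrow> 'u \<Rightarrow> 'v::comm_quantale) set" where
  "vrel X Y = {r. \<forall>x y. x \<notin> X \<or> y \<notin> Y \<longrightarrow> r x y = bot}"

definition vcomp :: "('u \<Rightarrow> 'u \<Rightarrow> 'v::comm_quantale) \<Rightarrow> ('u \<Rightarrow> 'u \<Rightarrow> 'v) \<Rightarrow> 'u \<Rightarrow> 'u \<Rightarrow> 'v"
    (infixl "\<cdot>" 70) where
  "s \<cdot> r = (\<lambda>x z. SUP y. r x y * s y z)"

definition vconv :: "('u \<Rightarrow> 'u \<Rightarrow> 'v::comm_quantale) \<Rightarrow> 'u \<Rightarrow> 'u \<Rightarrow> 'v" where
  "vconv r = (\<lambda>y x. r x y)"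

definition vgraph :: "'u set \<Rightarrow> ('u \<Rightarrow> 'u) \<Rightarrow> 'u \<Rightarrow> 'u \<Rightarrow> 'v::comm_quantale" where
  "vgraph X f = (\<lambda>x y. if x \<in> X \<and> f x = y then 1 else bot)"

section \<open>The category of sets\<close>

text \<open>HOL cannot quantify over endofunctors of the category of all sets, so this category is
  represented by the sets belonging to a universe \<open>U\<close>, with all (extensional) functions between
  them. The closure properties are those of a Grothendieck universe, where power sets are
  only required up to bijection because the elements need not be sets themselves. There is no axiom
  of infinity, so the finite subsets of an infinite type are also covered.\<close>

locale set_universe =
  fixes U :: "'u set set"
  assumes subset_closed: "\<lbrakk>X \<in> U; Y \<subseteq> X\<rbrakk> \<Longrightarrow> Y \<in> U"
    and image_closed: "X \<in> U \<Longrightarrow> f ` X \<in> U"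
    and singleton_closed: "{x} \<in> U"
    and Union_closed: "\<lbrakk>I \<in> U; \<And>i. i \<in> I \<Longrightarrow> F i \<in> U\<rbrakk> \<Longrightarrow> (\<Union>i\<in>I. F i) \<in> U"
    and Pow_closed: "X \<in> U \<Longrightarrow> \<exists>f. inj_on f (Pow X) \<and> f ` Pow X \<in> U"

lemma set_universe_finite: "set_universe {X :: nat set. finite X}"
proof
  fix X :: "nat set" assume "X \<in> {X. finite X}"
  then have "finite (Pow X)" by simp
  then obtain f :: "nat set \<Rightarrow> nat" where "inj_on f (Pow X)"
    using finite_imp_inj_to_nat_seg by metis
  with \<open>finite (Pow X)\<close> show "\<exists>f. inj_on f (Pow X) \<and> f ` Pow X \<in> {X :: nat set. finite X}"
    by blast
qed (auto intro: finite_subset)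

definition weak_pullback ::
    "'u set set \<Rightarrow> 'u set \<Rightarrow> 'u set \<Rightarrow> 'u set \<Rightarrow> 'u set \<Rightarrow>
     ('u \<Rightarrow> 'u) \<Rightarrow> ('u \<Rightarrow> 'u) \<Rightarrow> ('u \<Rightarrow> 'u) \<Rightarrow> ('u \<Rightarrow> 'u) \<Rightarrow> bool" where
  "weak_pullback U P X Y Z p q f g \<longleftrightarrow>
     P \<in> U \<and> X \<in> U \<and> Y \<in> U \<and> Z \<in> U \<and>
     p \<in> P \<rightarrow>\<^sub>E X \<and> q \<in> P \<rightarrow>\<^sub>E Y \<and> f \<in> X \<rightarrow>\<^sub>E Z \<and> g \<in> Y \<rightarrow>\<^sub>E Z \<and>
     compose P f p = compose P g q \<and>
     (\<forall>W\<in>U. \<forall>h \<in> W \<rightarrow>\<^sub>E X. \<forall>l \<in> W \<rightarrow>\<^sub>E Y. compose W f h = compose W g l \<longrightarrow>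
        (\<exists>t \<in> W \<rightarrow>\<^sub>E P. compose W p t = h \<and> compose W q t = l))"

section \<open>Monads on sets with a lax extension\<close>

text \<open>\<open>Tmap M X Y\<close> is the action on functions from \<open>X\<close> to \<open>Y\<close>, and \<open>Trel M X Y\<close> the action on
  relations from \<open>X\<close> to \<open>Y\<close>.\<close>

record ('u, 'v) lax_monad =
  sets :: "'u set set"
  Tob :: "'u set \<Rightarrow> 'u set"
  Tmap :: "'u set \<Rightarrow> 'u set \<Rightarrow> ('u \<Rightarrow> 'u) \<Rightarrow> 'u \<Rightarrow> 'u"
  unit :: "'u set \<Rightarrow> 'u \<Rightarrow> 'u"
  mult :: "'u set \<Rightarrow> 'u \<Rightarrow> 'u"
  Trel :: "'u set \<Rightarrow> 'u set \<Rightarrow> ('u \<Rightarrow> 'u \<Rightarrow> 'v) \<Rightarrow> 'u \<Rightarrow> 'u \<Rightarrow> 'v"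

locale set_monad =
  fixes M :: "('u, 'v) lax_monad"
  assumes universe: "set_universe (sets M)"
    and Tob_closed: "X \<in> sets M \<Longrightarrow> Tob M X \<in> sets M"
    and Tmap_closed:
      "\<lbrakk>X \<in> sets M; Y \<in> sets M; f \<in> X \<rightarrow>\<^sub>E Y\<rbrakk> \<Longrightarrow> Tmap M X Y f \<in> Tob M X \<rightarrow>\<^sub>E Tob M Y"
    and Tmap_id: "X \<in> sets M \<Longrightarrow> Tmap M X X (\<lambda>x\<in>X. x) = (\<lambda>x\<in>Tob M X. x)"
    and Tmap_compose:
      "\<lbrakk>X \<in> sets M; Y \<in> sets M; Z \<in> sets M; f \<in> X \<rightarrow>\<^sub>E Y; g \<in> Y \<rightarrow>\<^sub>E Z\<rbrakk> \<Longrightarrow>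
       Tmap M X Z (compose X g f) = compose (Tob M X) (Tmap M Y Z g) (Tmap M X Y f)"
    and unit_closed: "X \<in> sets M \<Longrightarrow> unit M X \<in> X \<rightarrow>\<^sub>E Tob M X"
    and mult_closed: "X \<in> sets M \<Longrightarrow> mult M X \<in> Tob M (Tob M X) \<rightarrow>\<^sub>E Tob M X"
    and unit_natural:
      "\<lbrakk>X \<in> sets M; Y \<in> sets M; f \<in> X \<rightarrow>\<^sub>E Y\<rbrakk> \<Longrightarrow>
       compose X (unit M Y) f = compose X (Tmap M X Y f) (unit M X)"
    and mult_natural:
      "\<lbrakk>X \<in> sets M; Y \<in> sets M; f \<in> X \<rightarrow>\<^sub>E Y\<rbrakk> \<Longrightarrow>
       compose (Tob M (Tob M X)) (mult M Y) (Tmap M (Tob M X) (Tob M Y) (Tmap M X Y f)) =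
       compose (Tob M (Tob M X)) (Tmap M X Y f) (mult M X)"
    and mult_unit:
      "X \<in> sets M \<Longrightarrow> compose (Tob M X) (mult M X) (unit M (Tob M X)) = (\<lambda>x\<in>Tob M X. x)"
    and mult_Tmap_unit:
      "X \<in> sets M \<Longrightarrow>
       compose (Tob M X) (mult M X) (Tmap M X (Tob M X) (unit M X)) = (\<lambda>x\<in>Tob M X. x)"
    and mult_assoc:
      "X \<in> sets M \<Longrightarrow>
       compose (Tob M (Tob M (Tob M X))) (mult M X) (mult M (Tob M X)) =
       compose (Tob M (Tob M (Tob M X))) (mult M X)
         (Tmap M (Tob M (Tob M X)) (Tob M X) (mult M X))"

text \<open>The condition (BC).\<close>

locale BC_monad = set_monad +
  assumes Tmap_weak_pullback:
      "weak_pullback (sets M) P X Y Z p q f g \<Longrightarrow>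
       weak_pullback (sets M) (Tob M P) (Tob M X) (Tob M Y) (Tob M Z)
         (Tmap M P X p) (Tmap M P Y q) (Tmap M X Z f) (Tmap M Y Z g)"
    and mult_weak_pullback:
      "\<lbrakk>X \<in> sets M; Y \<in> sets M; f \<in> X \<rightarrow>\<^sub>E Y\<rbrakk> \<Longrightarrow>
       weak_pullback (sets M) (Tob M (Tob M X)) (Tob M (Tob M Y)) (Tob M X) (Tob M Y)
         (Tmap M (Tob M X) (Tob M Y) (Tmap M X Y f)) (mult M X) (mult M Y) (Tmap M X Y f)"

text \<open>Flatness is the equation \<open>Trel_id\<close>; \<open>Trel_vgraph\<close> is the agreement with the functor on
  functions that comes with it.\<close>

locale lax_extended_monad = BC_monad M for M :: "('u, 'v::heyting_comm_quantale) lax_monad" +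
  assumes Trel_closed:
      "\<lbrakk>X \<in> sets M; Y \<in> sets M; r \<in> vrel X Y\<rbrakk> \<Longrightarrow> Trel M X Y r \<in> vrel (Tob M X) (Tob M Y)"
    and Trel_mono:
      "\<lbrakk>X \<in> sets M; Y \<in> sets M; r \<in> vrel X Y; s \<in> vrel X Y; r \<le> s\<rbrakk> \<Longrightarrow>
       Trel M X Y r \<le> Trel M X Y s"
    and Trel_vcomp:
      "\<lbrakk>X \<in> sets M; Y \<in> sets M; Z \<in> sets M; r \<in> vrel X Y; s \<in> vrel Y Z\<rbrakk> \<Longrightarrow>
       Trel M Y Z s \<cdot> Trel M X Y r \<le> Trel M X Z (s \<cdot> r)"
    and Trel_id:
      "X \<in> sets M \<Longrightarrow> Trel M X X (vgraph X (\<lambda>x\<in>X. x)) = vgraph (Tob M X) (\<lambda>x\<in>Tob M X. x)"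
    and Trel_vgraph:
      "\<lbrakk>X \<in> sets M; Y \<in> sets M; f \<in> X \<rightarrow>\<^sub>E Y\<rbrakk> \<Longrightarrow>
       Trel M X Y (vgraph X f) = vgraph (Tob M X) (Tmap M X Y f)"
    and Trel_vconv:
      "\<lbrakk>X \<in> sets M; Y \<in> sets M; r \<in> vrel X Y\<rbrakk> \<Longrightarrow>
       Trel M Y X (vconv r) = vconv (Trel M X Y r)"
    and unit_lax:
      "\<lbrakk>X \<in> sets M; Y \<in> sets M; r \<in> vrel X Y\<rbrakk> \<Longrightarrow>
       vgraph Y (unit M Y) \<cdot> r \<le> Trel M X Y r \<cdot> vgraph X (unit M X)"
    and mult_lax:
      "\<lbrakk>X \<in> sets M; Y \<in> sets M; r \<in> vrel X Y\<rbrakk> \<Longrightarrow>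
       vgraph (Tob M (Tob M Y)) (mult M Y) \<cdot> Trel M (Tob M X) (Tob M Y) (Trel M X Y r)
       \<le> Trel M X Y r \<cdot> vgraph (Tob M (Tob M X)) (mult M X)"

section \<open>Spaces and continuous maps\<close>

type_synonym ('u, 'v) space = "'u set \<times> ('u \<Rightarrow> 'u \<Rightarrow> 'v)"

definition structures ::
    "('u, 'v::comm_quantale) lax_monad \<Rightarrow> 'u set \<Rightarrow> ('u \<Rightarrow> 'u \<Rightarrow> 'v) set" where
  "structures M X = {a \<in> vrel (Tob M X) X.
     vgraph X (\<lambda>x\<in>X. x) \<le> a \<cdot> vgraph X (unit M X) \<and>
     a \<cdot> Trel M (Tob M X) X a \<le> a \<cdot> vgraph (Tob M (Tob M X)) (mult M X)}"

definition spaces :: "('u, 'v::comm_quantale) lax_monad \<Rightarrow> ('u, 'v) space set" where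
  "spaces M = {(X, a). X \<in> sets M \<and> a \<in> structures M X}"

definition continuous_maps ::
    "('u, 'v::comm_quantale) lax_monad \<Rightarrow> ('u, 'v) space \<Rightarrow> ('u, 'v) space \<Rightarrow> ('u \<Rightarrow> 'u) set" where
  "continuous_maps M = (\<lambda>(X, a) (Y, b).
     {f \<in> X \<rightarrow>\<^sub>E Y. vgraph X f \<cdot> a \<le> b \<cdot> vgraph (Tob M X) (Tmap M X Y f)})"

definition constants_continuous :: "('u, 'v::comm_quantale) lax_monad \<Rightarrow> bool" where
  "constants_continuous M \<longleftrightarrow>
     (\<forall>A \<in> spaces M. \<forall>B \<in> spaces M. \<forall>y \<in> fst B. (\<lambda>x\<in>fst A. y) \<in> continuous_maps M A B)"

section \<open>Generated spaces\<close>

definition final_for_probes ::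
    "('u, 'v::comm_quantale) lax_monad \<Rightarrow> ('u, 'v) space set \<Rightarrow> ('u, 'v) space \<Rightarrow>
     ('u \<Rightarrow> 'u \<Rightarrow> 'v) \<Rightarrow> bool" where
  "final_for_probes M \<C> A c \<longleftrightarrow> c \<in> structures M (fst A) \<and>
     (\<forall>B \<in> spaces M. \<forall>g \<in> fst A \<rightarrow>\<^sub>E fst B.
        g \<in> continuous_maps M (fst A, c) B \<longleftrightarrow>
        (\<forall>D \<in> \<C>. \<forall>p \<in> continuous_maps M D A. compose (fst D) g p \<in> continuous_maps M D B))"

definition generated_structure ::
    "('u, 'v::comm_quantale) lax_monad \<Rightarrow> ('u, 'v) space set \<Rightarrow> ('u, 'v) space \<Rightarrow>
     'u \<Rightarrow> 'u \<Rightarrow> 'v" where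
  "generated_structure M \<C> A = (THE c. final_for_probes M \<C> A c)"

definition generated_spaces ::
    "('u, 'v::comm_quantale) lax_monad \<Rightarrow> ('u, 'v) space set \<Rightarrow> ('u, 'v) space set" where
  "generated_spaces M \<C> = {A \<in> spaces M. snd A = generated_structure M \<C> A}"

section \<open>Coreflective full subcategories\<close>

text \<open>\<open>Comp A B C g f\<close> is the composite of \<open>f\<close> from \<open>A\<close> to \<open>B\<close> and \<open>g\<close> from \<open>B\<close> to \<open>C\<close>.\<close>

locale category =
  fixes Obj :: "'o set"
    and Hom :: "'o \<Rightarrow> 'o \<Rightarrow> 'm set"
    and Id :: "'o \<Rightarrow> 'm"
    and Comp :: "'o \<Rightarrow> 'o \<Rightarrow> 'o \<Rightarrow> 'm \<Rightarrow> 'm \<Rightarrow> 'm"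
  assumes Id_closed: "A \<in> Obj \<Longrightarrow> Id A \<in> Hom A A"
    and Comp_closed:
      "\<lbrakk>A \<in> Obj; B \<in> Obj; C \<in> Obj; f \<in> Hom A B; g \<in> Hom B C\<rbrakk> \<Longrightarrow> Comp A B C g f \<in> Hom A C"
    and Comp_Id_right: "\<lbrakk>A \<in> Obj; B \<in> Obj; f \<in> Hom A B\<rbrakk> \<Longrightarrow> Comp A A B f (Id A) = f"
    and Comp_Id_left: "\<lbrakk>A \<in> Obj; B \<in> Obj; f \<in> Hom A B\<rbrakk> \<Longrightarrow> Comp A B B (Id B) f = f"
    and Comp_assoc:
      "\<lbrakk>A \<in> Obj; B \<in> Obj; C \<in> Obj; D \<in> Obj; f \<in> Hom A B; g \<in> Hom B C; h \<in> Hom C D\<rbrakk> \<Longrightarrow>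
       Comp A C D h (Comp A B C g f) = Comp A B D (Comp B C D h g) f"

text \<open>The full subcategory is given by its class \<open>S\<close> of objects; every object \<open>B\<close> has a
  coreflection arrow \<open>c\<close>.\<close>

locale coreflective_full_subcategory = category Obj Hom Id Comp
  for Obj :: "'o set"
    and Hom :: "'o \<Rightarrow> 'o \<Rightarrow> 'm set"
    and Id :: "'o \<Rightarrow> 'm"
    and Comp :: "'o \<Rightarrow> 'o \<Rightarrow> 'o \<Rightarrow> 'm \<Rightarrow> 'm \<Rightarrow> 'm" +
  fixes S :: "'o set"
  assumes S_subset: "S \<subseteq> Obj"
    and coreflection:
      "B \<in> Obj \<Longrightarrow> \<exists>A\<in>S. \<exists>c \<in> Hom A B. \<forall>A'\<in>S. \<forall>f \<in> Hom A' B.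
         \<exists>!f'. f' \<in> Hom A' A \<and> Comp A' A B c f' = f"

end

theory Submission
  imports Defs
begin

text \<open>
  The structures on a set \<open>X\<close> are closed under pointwise infima of non-empty families, because
  reflexivity and transitivity only involve the values \<open>a (e x) x\<close> and \<open>a (m \<XX>) x\<close> on the larger
  side and monotone operations of \<open>a\<close> on the smaller one. So there is a least structure making
  all probes over \<open>(X, a)\<close> continuous (the family of such structures contains \<open>a\<close>). It is final:
  if all composites of probes with \<open>g\<close> are continuous into \<open>(Y, b)\<close>, then the initial
  structure \<open>b (Tg \<xx>) (g x)\<close> belongs to the family, and being above the infimum means
  precisely that \<open>g\<close> is continuous.

  Besides monotonicity, the lax extension enters through the transitivity of the initial
  structure. For it one needs that a pointwise bound \<open>s x y \<le> r (f x) (g y)\<close> is inherited by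
  the extensions, \<open>Ts \<xx> \<yy> \<le> Tr (Tf \<xx>) (Tg \<yy>)\<close> (\<open>Trel_le_Trel_Tmap\<close>); this holds since the
  bound is the inequality \<open>g \<cdot> s \<cdot> f\<degree> \<le> r\<close>, to which the lax functoriality applies.

  The coreflection of \<open>(X, a)\<close> is the identity map from \<open>(X, a\<^sup>c)\<close>. By finality both spaces
  have the same probes, so \<open>(X, a\<^sup>c)\<close> is generated; and a continuous map \<open>f\<close> from a generated
  space to \<open>(X, a)\<close> sends probes to probes, hence is continuous into \<open>(X, a\<^sup>c)\<close>.
\<close>

section \<open>Relations with values in a quantale\<close>

lemma quantale_mult_bot:
  fixes x :: "'v::comm_quantale"
  shows "x * bot = bot" and "bot * x = bot"
proof -
  show "x * bot = bot" using mult_Sup[of x "{}"] by simp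
  then show "bot * x = bot" by (simp add: mult.commute)
qed

lemma quantale_mult_mono:
  fixes x x' y y' :: "'v::comm_quantale"
  assumes "x \<le> x'" and "y \<le> y'"
  shows "x * y \<le> x' * y'"
proof -
  have *: "u * v \<le> u * w" if "v \<le> w" for u v w :: 'v
  proof -
    have "u * w = sup (u * v) (u * w)"
      using mult_Sup[of u "{v, w}"] that by (simp add: sup_absorb2)
    then show ?thesis by (metis sup_ge1)
  qed
  have "x * y \<le> x * y'" using *[OF assms(2)] .
  also have "\<dots> \<le> x' * y'" using *[OF assms(1), of y'] by (simp add: mult.commute)
  finally show ?thesis .
qed

lemma vcomp_vgraph_apply:
  fixes s :: "'u \<Rightarrow> 'u \<Rightarrow> 'v::comm_quantale"
  shows "(s \<cdot> vgraph X f) x z = (if x \<in> X then s (f x) z else bot)"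
proof (cases "x \<in> X")
  case True
  have "(SUP y. vgraph X f x y * s y z) = s (f x) z"
  proof (rule antisym)
    show "(SUP y. vgraph X f x y * s y z) \<le> s (f x) z"
      by (rule SUP_least) (auto simp: vgraph_def quantale_mult_bot)
    have "s (f x) z = vgraph X f x (f x) * s (f x) z"
      using True by (simp add: vgraph_def)
    also have "\<dots> \<le> (SUP y. vgraph X f x y * s y z)"
      by (rule SUP_upper) simp
    finally show "s (f x) z \<le> (SUP y. vgraph X f x y * s y z)" .
  qed
  then show ?thesis using True by (simp add: vcomp_def)
qed (simp add: vcomp_def vgraph_def quantale_mult_bot)

lemma vcomp_le_iff:
  fixes s :: "'u \<Rightarrow> 'u \<Rightarrow> 'v::comm_quantale"
  shows "s \<cdot> r \<le> q \<longleftrightarrow> (\<forall>x y z. r x y * s y z \<le> q x z)"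
  unfolding vcomp_def le_fun_def SUP_le_iff by blast

lemma le_vcomp:
  fixes s :: "'u \<Rightarrow> 'u \<Rightarrow> 'v::comm_quantale"
  shows "r x y * s y z \<le> (s \<cdot> r) x z"
  unfolding vcomp_def by (rule SUP_upper) simp

lemma vgraph_vcomp_le_iff:
  fixes r :: "'u \<Rightarrow> 'u \<Rightarrow> 'v::comm_quantale"
  shows "vgraph Y g \<cdot> r \<le> q \<longleftrightarrow> (\<forall>x. \<forall>y\<in>Y. r x y \<le> q x (g y))"
proof -
  have "r x y * vgraph Y g y z \<le> q x z \<longleftrightarrow> (y \<in> Y \<and> g y = z \<longrightarrow> r x y \<le> q x z)" for x y z
    by (auto simp: vgraph_def quantale_mult_bot)
  then show ?thesis by (auto simp: vcomp_le_iff)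
qed

lemma vcomp_vrel:
  fixes r :: "'u \<Rightarrow> 'u \<Rightarrow> 'v::comm_quantale"
  assumes "r \<in> vrel X Y" and "s \<in> vrel Y Z"
  shows "s \<cdot> r \<in> vrel X Z"
proof -
  have "r x y * s y z = bot" if "x \<notin> X \<or> z \<notin> Z" for x y z
  proof (cases "x \<in> X")
    case True
    then have "s y z = bot" using assms(2) that by (simp add: vrel_def)
    then show ?thesis by (simp add: quantale_mult_bot)
  next
    case False
    then have "r x y = bot" using assms(1) by (simp add: vrel_def)
    then show ?thesis by (simp add: quantale_mult_bot)
  qed
  then show ?thesis by (simp add: vrel_def vcomp_def)
qed

lemma vgraph_vrel:
  assumes "f \<in> X \<rightarrow>\<^sub>E Y"
  shows "vgraph X f \<in> vrel X Y"
  using assms by (auto simp: vrel_def vgraph_def)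

lemma vconv_vrel: "r \<in> vrel X Y \<Longrightarrow> vconv r \<in> vrel Y X"
  by (auto simp: vrel_def vconv_def)

lemma vrel_bot:
  assumes "r \<in> vrel X Y" and "x \<notin> X \<or> y \<notin> Y"
  shows "r x y = bot"
  using assms by (auto simp: vrel_def)

section \<open>Structures and continuity in terms of values\<close>

lemma continuous_maps_iff:
  assumes "a \<in> vrel (Tob M X) X"
  shows "f \<in> continuous_maps M (X, a) (Y, b) \<longleftrightarrow>
    f \<in> X \<rightarrow>\<^sub>E Y \<and> (\<forall>t\<in>Tob M X. \<forall>x\<in>X. a t x \<le> b (Tmap M X Y f t) (f x))"
proof -
  have *: "(\<forall>x\<in>X. a t x \<le> (if t \<in> Tob M X then b (Tmap M X Y f t) (f x) else bot)) \<longleftrightarrow>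
      (t \<in> Tob M X \<longrightarrow> (\<forall>x\<in>X. a t x \<le> b (Tmap M X Y f t) (f x)))" for t
    using vrel_bot[OF assms, of t] by (cases "t \<in> Tob M X") simp_all
  have "vgraph X f \<cdot> a \<le> b \<cdot> vgraph (Tob M X) (Tmap M X Y f) \<longleftrightarrow>
      (\<forall>t\<in>Tob M X. \<forall>x\<in>X. a t x \<le> b (Tmap M X Y f t) (f x))"
    unfolding vgraph_vcomp_le_iff vcomp_vgraph_apply * by blast
  then show ?thesis
    unfolding continuous_maps_def prod.case mem_Collect_eq by blast
qed

context lax_extended_monad
begin

lemma structures_iff:
  assumes X: "X \<in> sets M"
  shows "a \<in> structures M X \<longleftrightarrow> a \<in> vrel (Tob M X) X \<and>
    (\<forall>x\<in>X. 1 \<le> a (unit M X x) x) \<and>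
    (\<forall>w\<in>Tob M (Tob M X). \<forall>t\<in>Tob M X. \<forall>x\<in>X.
       Trel M (Tob M X) X a w t * a t x \<le> a (mult M X w) x)"
proof (cases "a \<in> vrel (Tob M X) X")
  case True
  have T: "Trel M (Tob M X) X a \<in> vrel (Tob M (Tob M X)) (Tob M X)"
    using Trel_closed[OF Tob_closed[OF X] X True] .
  have refl: "vgraph X (\<lambda>x\<in>X. x) \<le> a \<cdot> vgraph X (unit M X) \<longleftrightarrow>
      (\<forall>x\<in>X. 1 \<le> a (unit M X x) x)"
    unfolding le_fun_def vcomp_vgraph_apply by (auto simp: vgraph_def)
  have bot: "Trel M (Tob M X) X a w t * a t x = bot"
    if "w \<notin> Tob M (Tob M X) \<or> t \<notin> Tob M X \<or> x \<notin> X" for w t x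
    using that vrel_bot[OF T, of w t] vrel_bot[OF True, of t x]
    by (auto simp: quantale_mult_bot)
  have trans: "a \<cdot> Trel M (Tob M X) X a \<le> a \<cdot> vgraph (Tob M (Tob M X)) (mult M X) \<longleftrightarrow>
      (\<forall>w\<in>Tob M (Tob M X). \<forall>t\<in>Tob M X. \<forall>x\<in>X.
        Trel M (Tob M X) X a w t * a t x \<le> a (mult M X w) x)"
    unfolding vcomp_le_iff vcomp_vgraph_apply
  proof (intro iffI allI ballI)
    fix w t x
    assume le: "\<forall>w\<in>Tob M (Tob M X). \<forall>t\<in>Tob M X. \<forall>x\<in>X.
      Trel M (Tob M X) X a w t * a t x \<le> a (mult M X w) x"
    show "Trel M (Tob M X) X a w t * a t x
      \<le> (if w \<in> Tob M (Tob M X) then a (mult M X w) x else bot)"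
    proof (cases "w \<in> Tob M (Tob M X) \<and> t \<in> Tob M X \<and> x \<in> X")
      case True
      then show ?thesis using le by simp
    next
      case False
      then have "Trel M (Tob M X) X a w t * a t x = bot" using bot by blast
      then show ?thesis by simp
    qed
  next
    fix w t x
    assume le: "\<forall>w t x. Trel M (Tob M X) X a w t * a t x
      \<le> (if w \<in> Tob M (Tob M X) then a (mult M X w) x else bot)"
      and w: "w \<in> Tob M (Tob M X)"
    show "Trel M (Tob M X) X a w t * a t x \<le> a (mult M X w) x"
      using le[rule_format, of w t x] w by simp
  qed
  show ?thesis
    unfolding structures_def mem_Collect_eq refl trans using True by blast
qed (simp add: structures_def)

lemma structures_vrel: "a \<in> structures M X \<Longrightarrow> a \<in> vrel (Tob M X) X"
  by (simp add: structures_def)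

section \<open>Initial structures and infima of structures\<close>

text \<open>The hypothesis is the inequality \<open>g \<cdot> s \<cdot> f\<degree> \<le> r\<close>, and the conclusion is
  \<open>Tg \<cdot> Ts \<cdot> (Tf)\<degree> \<le> Tr\<close>. Composites are thus only ever compared in the direction in which the
  extension is lax.\<close>

lemma Trel_le_Trel_Tmap:
  assumes sets: "X \<in> sets M" "X' \<in> sets M" "Y \<in> sets M" "Y' \<in> sets M"
    and f: "f \<in> X \<rightarrow>\<^sub>E X'" and g: "g \<in> Y \<rightarrow>\<^sub>E Y'"
    and s: "s \<in> vrel X Y" and r: "r \<in> vrel X' Y'"
    and le: "\<And>x y. x \<in> X \<Longrightarrow> y \<in> Y \<Longrightarrow> s x y \<le> r (f x) (g y)"
    and t: "t \<in> Tob M X" and u: "u \<in> Tob M Y"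
  shows "Trel M X Y s t u \<le> Trel M X' Y' r (Tmap M X X' f t) (Tmap M Y Y' g u)"
proof -
  let ?f = "vconv (vgraph X f) :: 'u \<Rightarrow> 'u \<Rightarrow> 'v" and ?g = "vgraph Y g :: 'u \<Rightarrow> 'u \<Rightarrow> 'v"
  have f_vrel: "?f \<in> vrel X' X" using vconv_vrel[OF vgraph_vrel[OF f]] .
  have g_vrel: "?g \<in> vrel Y Y'" using vgraph_vrel[OF g] .
  have sf_vrel: "s \<cdot> ?f \<in> vrel X' Y" using vcomp_vrel[OF f_vrel s] .
  have Tf: "Trel M X' X ?f = vconv (vgraph (Tob M X) (Tmap M X X' f))"
    using Trel_vconv[OF sets(1,2) vgraph_vrel[OF f]] Trel_vgraph[OF sets(1,2) f] by simp
  have Tg: "Trel M Y Y' ?g = vgraph (Tob M Y) (Tmap M Y Y' g)"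
    using Trel_vgraph[OF sets(3,4) g] .
  have "s \<cdot> ?f \<le> (\<lambda>x' y. if y \<in> Y then r x' (g y) else bot)"
    using le vrel_bot[OF s] by (auto simp: vcomp_le_iff vconv_def vgraph_def quantale_mult_bot)
  then have "(s \<cdot> ?f) x' y \<le> r x' (g y)" if "y \<in> Y" for x' y
    using that by (simp add: le_fun_def) (metis)
  then have "?g \<cdot> (s \<cdot> ?f) \<le> r"
    by (simp add: vgraph_vcomp_le_iff)
  then have bound: "Trel M X' Y' (?g \<cdot> (s \<cdot> ?f)) \<le> Trel M X' Y' r"
    by (rule Trel_mono[OF sets(2,4) vcomp_vrel[OF sf_vrel g_vrel] r])
  have "Trel M X Y s t u = Trel M X' X ?f (Tmap M X X' f t) t * Trel M X Y s t u"
    unfolding Tf using t by (simp add: vconv_def vgraph_def)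
  also have "\<dots> \<le> (Trel M X Y s \<cdot> Trel M X' X ?f) (Tmap M X X' f t) u"
    by (rule le_vcomp)
  also have "\<dots> \<le> Trel M X' Y (s \<cdot> ?f) (Tmap M X X' f t) u"
    using Trel_vcomp[OF sets(2,1,3) f_vrel s] by (simp add: le_fun_def)
  also have "\<dots> = Trel M X' Y (s \<cdot> ?f) (Tmap M X X' f t) u
      * Trel M Y Y' ?g u (Tmap M Y Y' g u)"
    unfolding Tg using u by (simp add: vgraph_def)
  also have "\<dots> \<le> (Trel M Y Y' ?g \<cdot> Trel M X' Y (s \<cdot> ?f)) (Tmap M X X' f t) (Tmap M Y Y' g u)"
    by (rule le_vcomp)
  also have "\<dots> \<le> Trel M X' Y' (?g \<cdot> (s \<cdot> ?f)) (Tmap M X X' f t) (Tmap M Y Y' g u)"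
    using Trel_vcomp[OF sets(2,3,4) sf_vrel g_vrel] by (simp add: le_fun_def)
  also have "\<dots> \<le> Trel M X' Y' r (Tmap M X X' f t) (Tmap M Y Y' g u)"
    using bound by (simp add: le_fun_def)
  finally show ?thesis .
qed

lemma unit_Tmap:
  assumes "X \<in> sets M" and "Y \<in> sets M" and "f \<in> X \<rightarrow>\<^sub>E Y" and "x \<in> X"
  shows "Tmap M X Y f (unit M X x) = unit M Y (f x)"
  using fun_cong[OF unit_natural[OF assms(1-3)], of x] assms(4) by (simp add: compose_eq)

lemma mult_Tmap:
  assumes "X \<in> sets M" and "Y \<in> sets M" and "f \<in> X \<rightarrow>\<^sub>E Y" and "w \<in> Tob M (Tob M X)"
  shows "mult M Y (Tmap M (Tob M X) (Tob M Y) (Tmap M X Y f) w) = Tmap M X Y f (mult M X w)"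
  using fun_cong[OF mult_natural[OF assms(1-3)], of w] assms(4) by (simp add: compose_eq)

text \<open>The composite \<open>g\<degree> \<cdot> b \<cdot> Tg\<close> for \<open>B = (Y, b)\<close>.\<close>

definition initial_structure ::
    "'u set \<Rightarrow> ('u \<Rightarrow> 'u) \<Rightarrow> ('u, 'v) space \<Rightarrow> 'u \<Rightarrow> 'u \<Rightarrow> 'v" where
  "initial_structure X g B = (\<lambda>t x. if t \<in> Tob M X \<and> x \<in> X
     then snd B (Tmap M X (fst B) g t) (g x) else bot)"

lemma initial_structure_in_structures:
  assumes X: "X \<in> sets M" and B: "B \<in> spaces M" and g: "g \<in> X \<rightarrow>\<^sub>E fst B"
  shows "initial_structure X g B \<in> structures M X"
proof -
  obtain Y b where B_eq: "B = (Y, b)" by (cases B)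
  have Y: "Y \<in> sets M" and b: "b \<in> structures M Y"
    using B by (auto simp: B_eq spaces_def)
  have g: "g \<in> X \<rightarrow>\<^sub>E Y" using g by (simp add: B_eq)
  note b_vrel = structures_vrel[OF b]
  have Tg: "Tmap M X Y g \<in> Tob M X \<rightarrow>\<^sub>E Tob M Y" using Tmap_closed[OF X Y g] .
  have TTg: "Tmap M (Tob M X) (Tob M Y) (Tmap M X Y g) \<in> Tob M (Tob M X) \<rightarrow>\<^sub>E Tob M (Tob M Y)"
    using Tmap_closed[OF Tob_closed[OF X] Tob_closed[OF Y] Tg] .
  have gx: "g x \<in> Y" if "x \<in> X" for x using g that by auto
  have eX: "unit M X x \<in> Tob M X" if "x \<in> X" for x
    using unit_closed[OF X] that by auto
  have mX: "mult M X w \<in> Tob M X" if "w \<in> Tob M (Tob M X)" for w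
    using mult_closed[OF X] that by auto
  let ?c = "initial_structure X g B"
  have c_apply: "?c t x = b (Tmap M X Y g t) (g x)" if "t \<in> Tob M X" "x \<in> X" for t x
    using that by (simp add: initial_structure_def B_eq)
  have c_vrel: "?c \<in> vrel (Tob M X) X"
    by (auto simp: vrel_def initial_structure_def)
  have refl: "1 \<le> ?c (unit M X x) x" if "x \<in> X" for x
    using b gx[OF that] that eX[OF that] unit_Tmap[OF X Y g that]
    by (simp add: c_apply structures_iff[OF Y])
  have trans: "Trel M (Tob M X) X ?c w t * ?c t x \<le> ?c (mult M X w) x"
    if w: "w \<in> Tob M (Tob M X)" and t: "t \<in> Tob M X" and x: "x \<in> X" for w t x
  proof -
    let ?w = "Tmap M (Tob M X) (Tob M Y) (Tmap M X Y g) w" and ?t = "Tmap M X Y g t"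
    have "Trel M (Tob M X) X ?c w t \<le> Trel M (Tob M Y) Y b ?w ?t"
      by (rule Trel_le_Trel_Tmap[OF Tob_closed[OF X] Tob_closed[OF Y] X Y Tg g c_vrel b_vrel _ w t])
        (simp add: c_apply)
    then have "Trel M (Tob M X) X ?c w t * ?c t x \<le> Trel M (Tob M Y) Y b ?w ?t * b ?t (g x)"
      by (rule quantale_mult_mono) (simp add: c_apply t x)
    also have "\<dots> \<le> b (mult M Y ?w) (g x)"
    proof -
      have "?w \<in> Tob M (Tob M Y)" and "?t \<in> Tob M Y" using TTg Tg w t by auto
      then show ?thesis using b gx[OF x] by (simp add: structures_iff[OF Y])
    qed
    also have "\<dots> = ?c (mult M X w) x"
      by (simp add: c_apply mX[OF w] x mult_Tmap[OF X Y g w])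
    finally show ?thesis .
  qed
  show ?thesis using c_vrel refl trans by (simp add: structures_iff[OF X])
qed

text \<open>Non-emptiness of the family makes the infimum \<open>\<bottom>\<close> outside \<open>TX \<times> X\<close>; the infimum of the
  empty family is \<open>\<top>\<close> there.\<close>

lemma Inf_structures:
  assumes X: "X \<in> sets M" and S: "S \<subseteq> structures M X" "S \<noteq> {}"
  shows "Inf S \<in> structures M X"
proof -
  have Inf_apply2: "Inf S t x = (INF c\<in>S. c t x)" for t x
    by (simp add: image_image)
  have vrel: "Inf S \<in> vrel (Tob M X) X"
  proof -
    have "Inf S t x = bot" if "t \<notin> Tob M X \<or> x \<notin> X" for t x
    proof -
      obtain c where "c \<in> S" using S by blast
      then have "Inf S t x \<le> c t x" unfolding Inf_apply2 by (rule INF_lower)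
      moreover have "c t x = bot"
        using vrel_bot[OF structures_vrel that] S \<open>c \<in> S\<close> by blast
      ultimately show ?thesis by (simp add: bot_unique)
    qed
    then show ?thesis by (auto simp: vrel_def)
  qed
  have refl: "1 \<le> Inf S (unit M X x) x" if "x \<in> X" for x
    unfolding Inf_apply2 using S that by (intro INF_greatest) (auto simp: structures_iff[OF X])
  have trans: "Trel M (Tob M X) X (Inf S) w t * Inf S t x \<le> Inf S (mult M X w) x"
    if "w \<in> Tob M (Tob M X)" "t \<in> Tob M X" "x \<in> X" for w t x
    unfolding Inf_apply2[of "mult M X w"]
  proof (rule INF_greatest)
    fix c assume c: "c \<in> S"
    then have cs: "c \<in> structures M X" using S by blast
    have le: "Inf S \<le> c" using c by (rule Inf_lower)
    have "Trel M (Tob M X) X (Inf S) \<le> Trel M (Tob M X) X c"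
      using Trel_mono[OF Tob_closed[OF X] X vrel structures_vrel[OF cs] le] .
    then have "Trel M (Tob M X) X (Inf S) w t * Inf S t x \<le> Trel M (Tob M X) X c w t * c t x"
      using le by (intro quantale_mult_mono) (auto simp only: le_fun_def)
    also have "\<dots> \<le> c (mult M X w) x"
      using cs that by (simp add: structures_iff[OF X])
    finally show "Trel M (Tob M X) X (Inf S) w t * Inf S t x \<le> c (mult M X w) x" .
  qed
  show ?thesis unfolding structures_iff[OF X] using vrel refl trans by blast
qed

section \<open>The category of spaces\<close>

lemma spaces_iff: "A \<in> spaces M \<longleftrightarrow> fst A \<in> sets M \<and> snd A \<in> structures M (fst A)"
  by (auto simp: spaces_def)

lemma continuous_iff:
  assumes "A \<in> spaces M"
  shows "f \<in> continuous_maps M A B \<longleftrightarrow> f \<in> fst A \<rightarrow>\<^sub>E fst B \<and>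
    (\<forall>t\<in>Tob M (fst A). \<forall>x\<in>fst A. snd A t x \<le> snd B (Tmap M (fst A) (fst B) f t) (f x))"
  using continuous_maps_iff[of "snd A" M "fst A" f "fst B" "snd B"] assms structures_vrel
  by (simp add: spaces_iff)

lemma continuous_PiE:
  assumes "f \<in> continuous_maps M A B"
  shows "f \<in> fst A \<rightarrow>\<^sub>E fst B"
  using assms by (auto simp: continuous_maps_def split_def)

lemma continuous_compose:
  assumes A: "A \<in> spaces M" and B: "B \<in> spaces M" and D: "D \<in> spaces M"
    and f: "f \<in> continuous_maps M A B" and g: "g \<in> continuous_maps M B D"
  shows "compose (fst A) g f \<in> continuous_maps M A D"
proof -
  note fE = continuous_PiE[OF f] and gE = continuous_PiE[OF g]
  have sets: "fst A \<in> sets M" "fst B \<in> sets M" "fst D \<in> sets M"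
    using A B D by (auto simp: spaces_iff)
  have Tf: "Tmap M (fst A) (fst B) f \<in> Tob M (fst A) \<rightarrow>\<^sub>E Tob M (fst B)"
    using Tmap_closed[OF sets(1,2) fE] .
  have "snd A t x \<le> snd D (Tmap M (fst A) (fst D) (compose (fst A) g f) t) (compose (fst A) g f x)"
    if t: "t \<in> Tob M (fst A)" and x: "x \<in> fst A" for t x
  proof -
    have "snd A t x \<le> snd B (Tmap M (fst A) (fst B) f t) (f x)"
      using f t x by (simp add: continuous_iff[OF A])
    also have "\<dots> \<le> snd D (Tmap M (fst B) (fst D) g (Tmap M (fst A) (fst B) f t)) (g (f x))"
    proof -
      have "Tmap M (fst A) (fst B) f t \<in> Tob M (fst B)" and "f x \<in> fst B"
        using Tf fE t x by auto
      then show ?thesis using g by (simp add: continuous_iff[OF B])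
    qed
    finally show ?thesis
      using t x by (simp add: Tmap_compose[OF sets fE gE] compose_eq)
  qed
  moreover have "compose (fst A) g f \<in> fst A \<rightarrow>\<^sub>E fst D"
    using fE gE by (auto simp: compose_def)
  ultimately show ?thesis by (simp add: continuous_iff[OF A])
qed

lemma identity_continuous_iff:
  assumes X: "X \<in> sets M" and a: "a \<in> structures M X"
  shows "(\<lambda>x\<in>X. x) \<in> continuous_maps M (X, a) (X, b) \<longleftrightarrow> a \<le> b"
proof -
  have "a t x \<le> b t x" if "t \<notin> Tob M X \<or> x \<notin> X" for t x
    using vrel_bot[OF structures_vrel[OF a] that] by simp
  then show ?thesis
    by (auto simp: continuous_maps_iff[OF structures_vrel[OF a]] Tmap_id[OF X] le_fun_def)
qed

lemma compose_identity_left: "f \<in> X \<rightarrow>\<^sub>E Y \<Longrightarrow> compose X (\<lambda>y\<in>Y. y) f = f"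
  by (auto simp: compose_def fun_eq_iff PiE_def extensional_def)

lemma compose_identity_right: "f \<in> X \<rightarrow>\<^sub>E Y \<Longrightarrow> compose X f (\<lambda>x\<in>X. x) = f"
  by (auto simp: compose_def fun_eq_iff PiE_def extensional_def)

lemma category_of_spaces:
  "category (spaces M) (continuous_maps M) (\<lambda>A. \<lambda>x\<in>fst A. x) (\<lambda>A B D g f. compose (fst A) g f)"
proof
  fix A :: "('u, 'v) space"
  assume "A \<in> spaces M"
  then show "(\<lambda>x\<in>fst A. x) \<in> continuous_maps M A A"
    using identity_continuous_iff[of "fst A" "snd A" "snd A"] by (simp add: spaces_iff)
next
  fix A B C D :: "('u, 'v) space" and f g h
  assume "f \<in> continuous_maps M A B"
  note fE = continuous_PiE[OF this]
  show "compose (fst A) h (compose (fst A) g f) = compose (fst A) (compose (fst B) h g) f"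
    using fE by (auto simp: compose_def fun_eq_iff)
qed (auto intro: continuous_compose compose_identity_left compose_identity_right
      dest: continuous_PiE)

section \<open>The final structure for the probes\<close>

text \<open>Two final structures agree since the identity is continuous in both directions.\<close>

lemma final_for_probes_le:
  assumes \<C>: "\<C> \<subseteq> spaces M" and A: "A \<in> spaces M"
    and c: "final_for_probes M \<C> A c" and d: "final_for_probes M \<C> A d"
  shows "c \<le> d"
proof -
  let ?id = "\<lambda>x\<in>fst A. x"
  have X: "fst A \<in> sets M" using A by (simp add: spaces_iff)
  have cs: "c \<in> structures M (fst A)" and ds: "d \<in> structures M (fst A)"
    using c d by (simp_all add: final_for_probes_def)
  have D: "(fst A, d) \<in> spaces M" using X ds by (simp add: spaces_iff)
  have "?id \<in> continuous_maps M (fst A, d) (fst A, d)"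
    using identity_continuous_iff[OF X ds] by simp
  then have "\<forall>E\<in>\<C>. \<forall>p\<in>continuous_maps M E A. compose (fst E) ?id p \<in> continuous_maps M E (fst A, d)"
    using d D by (simp add: final_for_probes_def)
  then have "?id \<in> continuous_maps M (fst A, c) (fst A, d)"
    using c D by (simp add: final_for_probes_def)
  then show ?thesis using identity_continuous_iff[OF X cs] by simp
qed

lemma generated_structure_eqI:
  assumes "\<C> \<subseteq> spaces M" and "A \<in> spaces M" and "final_for_probes M \<C> A c"
  shows "generated_structure M \<C> A = c"
  unfolding generated_structure_def
  using assms by (blast intro: the_equality antisym final_for_probes_le)

text \<open>The final structure is the infimum of all structures that make the probes continuous.
  Finality holds because the initial structure of a map \<open>g\<close> is one of them as soon as \<open>g\<close>
  is continuous along all probes.\<close>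

lemma final_for_probes_exists:
  assumes \<C>: "\<C> \<subseteq> spaces M" and A: "A \<in> spaces M"
  shows "\<exists>c. final_for_probes M \<C> A c"
proof -
  let ?X = "fst A"
  define S where "S = {c \<in> structures M ?X.
    \<forall>D\<in>\<C>. \<forall>p\<in>continuous_maps M D A. p \<in> continuous_maps M D (?X, c)}"
  have X: "?X \<in> sets M" using A by (simp add: spaces_iff)
  have "snd A \<in> S" using A by (simp add: S_def spaces_iff)
  moreover have "S \<subseteq> structures M ?X" by (auto simp: S_def)
  ultimately have Inf_structure: "Inf S \<in> structures M ?X"
    using Inf_structures[OF X] by blast
  then have Inf_space: "(?X, Inf S) \<in> spaces M" using X by (simp add: spaces_iff)
  have probe: "p \<in> continuous_maps M D (?X, Inf S)"
    if D: "D \<in> \<C>" and p: "p \<in> continuous_maps M D A" for D p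
  proof -
    have Ds: "D \<in> spaces M" using D \<C> by blast
    have "p \<in> continuous_maps M D (?X, c)" if "c \<in> S" for c
      using that D p by (simp add: S_def)
    then have "snd D t x \<le> c (Tmap M (fst D) ?X p t) (p x)"
      if "c \<in> S" "t \<in> Tob M (fst D)" "x \<in> fst D" for c t x
      using that by (simp add: continuous_iff[OF Ds])
    then show ?thesis
      using continuous_PiE[OF p] by (auto simp: continuous_iff[OF Ds] image_image intro!: INF_greatest)
  qed
  have lift: "g \<in> continuous_maps M (?X, Inf S) B"
    if B: "B \<in> spaces M" and g: "g \<in> ?X \<rightarrow>\<^sub>E fst B"
      and gp: "\<And>D p. D \<in> \<C> \<Longrightarrow> p \<in> continuous_maps M D A \<Longrightarrow>
        compose (fst D) g p \<in> continuous_maps M D B" for B g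
  proof -
    let ?c = "initial_structure ?X g B"
    have Y: "fst B \<in> sets M" using B by (simp add: spaces_iff)
    have "p \<in> continuous_maps M D (?X, ?c)"
      if D: "D \<in> \<C>" and p: "p \<in> continuous_maps M D A" for D p
    proof -
      have Ds: "D \<in> spaces M" using D \<C> by blast
      then have Z: "fst D \<in> sets M" by (simp add: spaces_iff)
      note pE = continuous_PiE[OF p]
      have Tp: "Tmap M (fst D) ?X p \<in> Tob M (fst D) \<rightarrow>\<^sub>E Tob M ?X"
        using Tmap_closed[OF Z X pE] .
      have "snd D t x \<le> ?c (Tmap M (fst D) ?X p t) (p x)"
        if t: "t \<in> Tob M (fst D)" and x: "x \<in> fst D" for t x
      proof -
        have "Tmap M (fst D) ?X p t \<in> Tob M ?X" and "p x \<in> ?X"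
          using Tp pE t x by auto
        moreover have "snd D t x \<le>
            snd B (Tmap M (fst D) (fst B) (compose (fst D) g p) t) (compose (fst D) g p x)"
          using gp[OF D p] t x by (simp add: continuous_iff[OF Ds])
        ultimately show ?thesis
          using t x by (simp add: initial_structure_def Tmap_compose[OF Z X Y pE g] compose_eq)
      qed
      then show ?thesis using pE by (simp add: continuous_iff[OF Ds])
    qed
    then have "?c \<in> S"
      using initial_structure_in_structures[OF X B g] by (simp add: S_def)
    then have le: "Inf S \<le> ?c" by (rule Inf_lower)
    have "Inf S t x \<le> snd B (Tmap M ?X (fst B) g t) (g x)"
      if "t \<in> Tob M ?X" "x \<in> ?X" for t x
    proof -
      have "Inf S t x \<le> ?c t x" using le by (simp only: le_fun_def)
      also have "\<dots> = snd B (Tmap M ?X (fst B) g t) (g x)"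
        using that by (simp add: initial_structure_def)
      finally show ?thesis .
    qed
    then show ?thesis
      unfolding continuous_iff[OF Inf_space] fst_conv snd_conv using g by blast
  qed
  have "final_for_probes M \<C> A (Inf S)"
    unfolding final_for_probes_def
  proof (intro conjI ballI iffI)
    fix B g D p
    assume "B \<in> spaces M" and "g \<in> continuous_maps M (?X, Inf S) B"
      and "D \<in> \<C>" and "p \<in> continuous_maps M D A"
    then show "compose (fst D) g p \<in> continuous_maps M D B"
      using continuous_compose[OF _ Inf_space _ probe] \<C> by blast
  qed (auto intro: lift Inf_structure)
  then show ?thesis by blast
qed

lemma final_generated_structure:
  assumes "\<C> \<subseteq> spaces M" and "A \<in> spaces M"
  shows "final_for_probes M \<C> A (generated_structure M \<C> A)"
  using final_for_probes_exists[OF assms] generated_structure_eqI[OF assms] by metis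

lemma generated_structure_space:
  assumes "\<C> \<subseteq> spaces M" and "A \<in> spaces M"
  shows "(fst A, generated_structure M \<C> A) \<in> spaces M"
  using final_generated_structure[OF assms] assms(2)
  by (simp add: spaces_iff final_for_probes_def)

section \<open>The coreflection\<close>

lemma counit_continuous:
  assumes \<C>: "\<C> \<subseteq> spaces M" and A: "A \<in> spaces M"
  shows "(\<lambda>x\<in>fst A. x) \<in> continuous_maps M (fst A, generated_structure M \<C> A) A"
proof -
  have "compose (fst D) (\<lambda>x\<in>fst A. x) p \<in> continuous_maps M D A"
    if "p \<in> continuous_maps M D A" for D p
    using that compose_identity_left[OF continuous_PiE[OF that]] by simp
  moreover have "(\<lambda>x\<in>fst A. x) \<in> fst A \<rightarrow>\<^sub>E fst A" by auto
  ultimately show ?thesis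
    using final_generated_structure[OF \<C> A] A unfolding final_for_probes_def by blast
qed

lemma probes_generated_structure:
  assumes \<C>: "\<C> \<subseteq> spaces M" and A: "A \<in> spaces M" and D: "D \<in> \<C>"
  shows "continuous_maps M D (fst A, generated_structure M \<C> A) = continuous_maps M D A"
proof -
  let ?A = "(fst A, generated_structure M \<C> A)" and ?id = "\<lambda>x\<in>fst A. x"
  have As: "?A \<in> spaces M" using generated_structure_space[OF \<C> A] .
  have Ds: "D \<in> spaces M" using \<C> D by blast
  have id: "?id \<in> fst A \<rightarrow>\<^sub>E fst ?A" by auto
  have comp: "compose (fst D) ?id p = p"
    if "p \<in> continuous_maps M D A \<or> p \<in> continuous_maps M D ?A" for p
    using that compose_identity_left by (force dest: continuous_PiE)
  have "?id \<in> continuous_maps M ?A ?A"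
    using identity_continuous_iff[of "fst A"] As by (simp add: spaces_iff)
  then have "\<forall>p\<in>continuous_maps M D A. compose (fst D) ?id p \<in> continuous_maps M D ?A"
    using final_generated_structure[OF \<C> A] As id D unfolding final_for_probes_def by blast
  moreover have "\<forall>p\<in>continuous_maps M D ?A. compose (fst D) ?id p \<in> continuous_maps M D A"
    using continuous_compose[OF Ds As A _ counit_continuous[OF \<C> A]] by blast
  ultimately show ?thesis by (auto simp: comp)
qed

text \<open>Finality depends on a space only through its underlying set and its probes.\<close>

lemma generated_structure_generated:
  assumes \<C>: "\<C> \<subseteq> spaces M" and A: "A \<in> spaces M"
  shows "(fst A, generated_structure M \<C> A) \<in> generated_spaces M \<C>"
proof -
  let ?A = "(fst A, generated_structure M \<C> A)"
  have As: "?A \<in> spaces M" using generated_structure_space[OF \<C> A] .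
  have "final_for_probes M \<C> ?A (generated_structure M \<C> A)"
    using final_generated_structure[OF \<C> A]
    by (simp add: final_for_probes_def probes_generated_structure[OF \<C> A] cong: ball_cong)
  then have "generated_structure M \<C> ?A = generated_structure M \<C> A"
    by (rule generated_structure_eqI[OF \<C> As])
  then show ?thesis using As by (simp add: generated_spaces_def)
qed

lemma continuous_into_generated_structure:
  assumes \<C>: "\<C> \<subseteq> spaces M" and B: "B \<in> spaces M" and A: "A \<in> generated_spaces M \<C>"
    and f: "f \<in> continuous_maps M A B"
  shows "f \<in> continuous_maps M A (fst B, generated_structure M \<C> B)"
proof -
  let ?B = "(fst B, generated_structure M \<C> B)"
  have As: "A \<in> spaces M" and A_eq: "(fst A, generated_structure M \<C> A) = A"
    using A by (auto simp: generated_spaces_def prod_eq_iff)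
  have Bs: "?B \<in> spaces M" using generated_structure_space[OF \<C> B] .
  have "compose (fst D) f p \<in> continuous_maps M D ?B"
    if D: "D \<in> \<C>" and p: "p \<in> continuous_maps M D A" for D p
    unfolding probes_generated_structure[OF \<C> B D]
    using continuous_compose[OF _ As B p f] \<C> D by blast
  moreover have "f \<in> fst A \<rightarrow>\<^sub>E fst ?B" using continuous_PiE[OF f] by simp
  ultimately show ?thesis
    using final_generated_structure[OF \<C> As] Bs unfolding final_for_probes_def A_eq by blast
qed

end

theorem mainTheorem2:
  fixes M :: "('u, 'v::heyting_comm_quantale) lax_monad"
    and \<C> :: "('u, 'v) space set"
  assumes "lax_extended_monad M"
    and "constants_continuous M"
    and "\<C> \<subseteq> spaces M"
    and "\<exists>A\<in>\<C>. fst A \<noteq> {}"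
  shows "coreflective_full_subcategory (spaces M) (continuous_maps M)
    (\<lambda>A. \<lambda>x\<in>fst A. x) (\<lambda>A B D g f. compose (fst A) g f) (generated_spaces M \<C>)"
proof -
  interpret lax_extended_monad M by fact
  note \<C> = \<open>\<C> \<subseteq> spaces M\<close>
  interpret category "spaces M" "continuous_maps M" "\<lambda>A. \<lambda>x\<in>fst A. x"
    "\<lambda>A B D g f. compose (fst A) g f"
    by (rule category_of_spaces)
  show ?thesis
  proof
    show "generated_spaces M \<C> \<subseteq> spaces M" by (auto simp: generated_spaces_def)
  next
    fix B assume B: "B \<in> spaces M"
    let ?B = "(fst B, generated_structure M \<C> B)" and ?id = "\<lambda>x\<in>fst B. x"
    have "\<exists>!f'. f' \<in> continuous_maps M A ?B \<and> compose (fst A) ?id f' = f"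
      if A: "A \<in> generated_spaces M \<C>" and f: "f \<in> continuous_maps M A B" for A f
    proof (rule ex1I[of _ f])
      show "f \<in> continuous_maps M A ?B \<and> compose (fst A) ?id f = f"
        using continuous_into_generated_structure[OF \<C> B A f]
          compose_identity_left[OF continuous_PiE[OF f]] by simp
    next
      fix f' assume f': "f' \<in> continuous_maps M A ?B \<and> compose (fst A) ?id f' = f"
      then have "f' \<in> fst A \<rightarrow>\<^sub>E fst B" using continuous_PiE[of f' A ?B] by simp
      then show "f' = f" using f' compose_identity_left by metis
    qed
    then show "\<exists>A\<in>generated_spaces M \<C>. \<exists>c\<in>continuous_maps M A B.
        \<forall>A'\<in>generated_spaces M \<C>. \<forall>f\<in>continuous_maps M A' B.
          \<exists>!f'. f' \<in> continuous_maps M A' A \<and> compose (fst A') c f' = f"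
      using generated_structure_generated[OF \<C> B] counit_continuous[OF \<C> B] by blast
  qed
qed

end
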